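(* Let $\alpha\in(0,1/2)$ and fix $\delta\in(0,1/4]$. Call a pair $ij$ $\delta$-good if $|w_{ij}|\le\delta\alpha$. Then for any types $a\in[\alpha,1-\alpha]^k$ and any $d$-regular graph $H$ on the vertex set $S=\{1,\dots,k\}$, $$\mathbb P(G[S]=H\mid a)\ \le\ \bar a^{\,m}(1-\bar a)^{K-m}\exp\Bigl(-(1-\delta)\Bigl[\sum_{\substack{ij\in E(H)\\ \delta\text{-good}}}\frac{w_{ij}^2}{2\bar a^2}+\sum_{\substack{ij\notin E(H)\\ \delta\text{-good}}}\frac{w_{ij}^2}{2(1-\bar a)^2}\Bigr]\Bigr).$$ In particular, if $\max_i|y_i|\le\delta\alpha$ then every pair is $\delta$-good and the bracket equals $y^{\mathsf T}Q_Hy$, where $$Q_H=\tfrac18\Bigl[\bigl(\tfrac{d}{\bar a^2}+\tfrac{k-2-d}{(1-\bar a)^2}\bigr)I+\bigl(\tfrac1{\bar a^2}-\tfrac1{(1-\bar a)^2}\bigr)A_H\Bigr]$$ and $A_H$ is the adjacency matrix of $H$.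
   Context: For types $a=(a_1,\dots,a_k)$ write $\bar a=k^{-1}\sum_i a_i$, $y_i=a_i-\bar a$ (so $\sum_i y_i=0$), $y=(y_1,\dots,y_k)$, $w_{ij}=(y_i+y_j)/2$, $K=\binom k2$, and for a $d$-regular graph $H$ on $S$, $m=kd/2$ (its number of edges). Conditionally on $a$, $G[S]$ is the random graph on $S$ in which each pair $ij$ of distinct vertices is an edge independently with probability $(a_i+a_j)/2$. Sums over $ij\in E(H)$ and $ij\notin E(H)$ are over unordered pairs of distinct vertices of $S$. *)

theory Defs
  imports "HOL-Analysis.Analysis" "HOL-Probability.Product_PMF" "HOL-Library.Ramsey"
begin

text \<open>
  The vertex set \<open>S = {1, \<dots>, k}\<close> is the universe of a finite index type \<open>'n\<close>, so
  \<open>k = CARD('n)\<close> and types are vectors in \<open>real ^ 'n\<close>.  An unordered pair \<open>ij\<close> of distinct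
  vertices is a two-element set, i.e. an element of \<open>nsets UNIV 2\<close>, and a simple graph on \<open>S\<close>
  is represented by its edge set \<open>E \<subseteq> nsets UNIV 2\<close>.
\<close>

definition mean :: "real ^ 'n \<Rightarrow> real" where
  "mean a = (\<Sum>i\<in>UNIV. a $ i) / real CARD('n)"

definition dev :: "real ^ 'n \<Rightarrow> real ^ 'n" where
  "dev a = (\<chi> i. a $ i - mean a)"

text \<open>The average over an unordered pair; see \<open>pair_avg_doubleton\<close> below.\<close>

definition pair_avg :: "real ^ 'n \<Rightarrow> 'n set \<Rightarrow> real" where
  "pair_avg v e = (\<Sum>i\<in>e. v $ i) / 2"

lemma pair_avg_doubleton: "i \<noteq> j \<Longrightarrow> pair_avg v {i, j} = (v $ i + v $ j) / 2"
  by (simp add: pair_avg_def)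

text \<open>\<open>pair_w a {i, j}\<close> is \<open>w\<^sub>i\<^sub>j = (y\<^sub>i + y\<^sub>j) / 2\<close>.\<close>

definition pair_w :: "real ^ 'n \<Rightarrow> 'n set \<Rightarrow> real" where
  "pair_w a e = pair_avg (dev a) e"

definition good_pair :: "real \<Rightarrow> real \<Rightarrow> real ^ 'n \<Rightarrow> 'n set \<Rightarrow> bool" where
  "good_pair \<alpha> \<delta> a e \<longleftrightarrow> \<bar>pair_w a e\<bar> \<le> \<delta> * \<alpha>"

text \<open>The conditional law of \<open>G[S]\<close> given the types \<open>a\<close>, as a distribution on edge sets:
  independent Bernoulli indicators, with probability \<open>(a\<^sub>i + a\<^sub>j) / 2\<close> for the pair \<open>ij\<close>.\<close>

definition random_graph :: "real ^ 'n \<Rightarrow> 'n set set pmf" where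
  "random_graph a =
     map_pmf (\<lambda>X. {e \<in> nsets UNIV 2. X e})
       (Pi_pmf (nsets UNIV 2) False (\<lambda>e. bernoulli_pmf (pair_avg a e)))"

definition regular_graph :: "nat \<Rightarrow> 'n set set \<Rightarrow> bool" where
  "regular_graph d E \<longleftrightarrow> E \<subseteq> nsets UNIV 2 \<and> (\<forall>i. card {e \<in> E. i \<in> e} = d)"

definition adj_matrix :: "'n set set \<Rightarrow> real ^ 'n ^ 'n" where
  "adj_matrix E = (\<chi> i j. if {i, j} \<in> E then 1 else 0)"

definition bracket :: "real \<Rightarrow> real \<Rightarrow> real ^ 'n \<Rightarrow> 'n set set \<Rightarrow> real" where
  "bracket \<alpha> \<delta> a E =
     (\<Sum>e | e \<in> E \<and> good_pair \<alpha> \<delta> a e. (pair_w a e)\<^sup>2 / (2 * (mean a)\<^sup>2)) +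
     (\<Sum>e | e \<in> nsets UNIV 2 \<and> e \<notin> E \<and> good_pair \<alpha> \<delta> a e.
        (pair_w a e)\<^sup>2 / (2 * (1 - mean a)\<^sup>2))"

definition Q_matrix :: "nat \<Rightarrow> real ^ 'n \<Rightarrow> 'n set set \<Rightarrow> real ^ 'n ^ 'n" where
  "Q_matrix d a E =
     (1 / 8) *\<^sub>R
       ((real d / (mean a)\<^sup>2 + (real CARD('n) - 2 - real d) / (1 - mean a)\<^sup>2) *\<^sub>R mat 1 +
        (1 / (mean a)\<^sup>2 - 1 / (1 - mean a)\<^sup>2) *\<^sub>R adj_matrix E)"

text \<open>A \<open>d\<close>-regular graph on \<open>k\<close> vertices has exactly \<open>k d / 2\<close> edges: \<open>k d\<close> is even,
  so \<open>k * d div 2\<close> is an exact division.\<close>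

lemma regular_graph_card_edges:
  fixes E :: "'n::finite set set"
  assumes "regular_graph d E"
  shows "2 * card E = CARD('n) * d"
proof -
  have two: "card e = 2" if "e \<in> E" for e
    using assms that by (auto simp: regular_graph_def nsets_def)
  have "2 * card E = (\<Sum>e\<in>E. card {i. i \<in> e})"
    using two by simp
  also have "\<dots> = (\<Sum>e\<in>E. \<Sum>i\<in>UNIV. if i \<in> e then 1 else 0)"
    by (simp add: sum.If_cases)
  also have "\<dots> = (\<Sum>i\<in>UNIV. \<Sum>e\<in>E. if i \<in> e then 1 else 0)"
    by (rule sum.swap)
  also have "\<dots> = (\<Sum>i\<in>(UNIV::'n set). card {e \<in> E. i \<in> e})"
    by (simp add: sum.If_cases Int_def)
  also have "\<dots> = CARD('n) * d"
    using assms by (simp add: regular_graph_def)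
  finally show ?thesis .
qed

end

theory Submission
  imports Defs
begin

text \<open>
  Write \<open>p\<close> for the mean type, \<open>q = 1 - p\<close>, and \<open>w\<^sub>e\<close> for the deviation of the pair \<open>e\<close>.  By
  independence the probability of \<open>H\<close> is the product of \<open>p + w\<^sub>e\<close> over the edges and of
  \<open>q - w\<^sub>e\<close> over the non-edges.  Each factor \<open>c + t\<close> (with \<open>c = p, t = w\<^sub>e\<close> or
  \<open>c = q, t = - w\<^sub>e\<close>) is at most \<open>c exp (t / c)\<close>, and when \<open>t / c\<close> is at most \<open>\<delta>\<close> in absolute
  value, a second-order expansion of the logarithm improves this to
  \<open>c exp (t / c - (1 - \<delta>) t\<^sup>2 / (2 c\<^sup>2))\<close> (\<open>factor_bound\<close>).  Good pairs satisfy this condition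
  since \<open>p\<close> and \<open>q\<close> are both at least \<open>\<alpha>\<close>.  Multiplying up gives the claimed bound times the
  exponential of the linear terms.

  Regularity removes those linear terms: every vertex contributes its deviation to the sum of
  \<open>w\<^sub>e\<close> over \<open>H\<close> with the same weight \<open>d / 2\<close>, and the deviations sum to zero.  The complete
  graph is regular too, so the sum over the non-edges also vanishes (\<open>sum_pair_w_regular\<close>).

  The quadratic form comes from the incidence matrix \<open>B\<close> of a \<open>d\<close>-regular graph, for which
  \<open>B B\<^sup>T = d I + A\<close>: the sum over edges of \<open>(y\<^sub>i + y\<^sub>j)\<^sup>2\<close> is \<open>y \<bullet> (d I + A) y\<close>
  (\<open>sum_incidence_square\<close>).  Applying it to \<open>H\<close> and to the complete graph, whose form reduces
  to \<open>(k - 2) |y|\<^sup>2\<close> on vectors with zero sum, yields both parts of \<open>Q\<^sub>H\<close>.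
\<close>

section \<open>A second-order bound on one Bernoulli factor\<close>

text \<open>
  The difference of the two sides of the logarithmic inequality has derivative
  \<open>x (\<delta> - (1 - \<delta>) x) / (1 + x)\<close>, which has the sign of \<open>x\<close> as long as \<open>x \<le> \<delta>\<close>, so the
  difference is least at \<open>x = 0\<close>, where it vanishes.
\<close>

lemma ln_one_plus_le_quadratic:
  fixes x \<delta> :: real
  assumes "0 \<le> \<delta>" "\<delta> \<le> 1" "-1 < x" "x \<le> \<delta>"
  shows "ln (1 + x) \<le> x - (1 - \<delta>) * x\<^sup>2 / 2"
proof -
  define f where "f t = t - (1 - \<delta>) * t\<^sup>2 / 2 - ln (1 + t)" for t :: real
  have deriv: "(f has_real_derivative t * (\<delta> - (1 - \<delta>) * t) / (1 + t)) (at t)"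
    if "-1 < t" for t
    unfolding f_def using that
    by (auto intro!: derivative_eq_intros simp: field_simps power2_eq_square)
  have slack: "0 \<le> \<delta> - (1 - \<delta>) * t" if "t \<le> \<delta>" for t
  proof -
    have "(1 - \<delta>) * t \<le> (1 - \<delta>) * \<delta>"
      using that assms by (intro mult_left_mono) auto
    also have "\<dots> \<le> \<delta>"
      by (simp add: algebra_simps)
    finally show ?thesis by simp
  qed
  have "f 0 \<le> f x"
  proof (cases "0 \<le> x")
    case True
    show ?thesis
    proof (rule DERIV_nonneg_imp_nondecreasing[OF True])
      fix t assume "0 \<le> t" "t \<le> x"
      with slack[of t] assms have "0 \<le> t * (\<delta> - (1 - \<delta>) * t) / (1 + t)"
        by simp
      with deriv[of t] \<open>0 \<le> t\<close> show "\<exists>y. (f has_real_derivative y) (at t) \<and> 0 \<le> y"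
        by auto
    qed
  next
    case False
    then have "x \<le> 0" by simp
    then show ?thesis
    proof (rule DERIV_nonpos_imp_nonincreasing)
      fix t assume "x \<le> t" "t \<le> 0"
      with slack[of t] assms have "t * (\<delta> - (1 - \<delta>) * t) / (1 + t) \<le> 0"
        by (intro divide_nonpos_pos mult_nonpos_nonneg) auto
      with deriv[of t] \<open>x \<le> t\<close> assms show "\<exists>y. (f has_real_derivative y) (at t) \<and> y \<le> 0"
        by auto
    qed
  qed
  then show ?thesis
    by (simp add: f_def)
qed

text \<open>
  The single estimate behind the probability bound: an edge factor is \<open>c + t\<close> with \<open>c\<close> the mean
  and \<open>t\<close> the pair deviation, a non-edge factor has \<open>c\<close> and \<open>t\<close> replaced by \<open>1 - c\<close> and \<open>- t\<close>.
\<close>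

lemma factor_bound:
  fixes \<alpha> \<delta> c t :: real
  assumes "0 < \<alpha>" "\<alpha> \<le> c" "0 \<le> \<delta>" "\<delta> < 1"
  shows "c + t \<le> c * exp (t / c - (1 - \<delta>) * (if \<bar>t\<bar> \<le> \<delta> * \<alpha> then t\<^sup>2 / (2 * c\<^sup>2) else 0))"
proof -
  have c: "0 < c" using assms by simp
  have "1 + t / c \<le> exp (t / c - (1 - \<delta>) * (if \<bar>t\<bar> \<le> \<delta> * \<alpha> then t\<^sup>2 / (2 * c\<^sup>2) else 0))"
  proof (cases "\<bar>t\<bar> \<le> \<delta> * \<alpha>")
    case True
    also have "\<delta> * \<alpha> \<le> \<delta> * c"
      using assms by (intro mult_left_mono) auto
    finally have "\<bar>t / c\<bar> \<le> \<delta>"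
      using c by (simp add: divide_le_eq)
    then have range: "-1 < t / c" "t / c \<le> \<delta>"
      using assms by linarith+
    then have "1 + t / c = exp (ln (1 + t / c))"
      by simp
    also have "\<dots> \<le> exp (t / c - (1 - \<delta>) * (t / c)\<^sup>2 / 2)"
      unfolding exp_le_cancel_iff
      by (rule ln_one_plus_le_quadratic) (use range assms in auto)
    finally show ?thesis
      using True by (simp add: power_divide mult.commute)
  next
    case False
    then show ?thesis
      using exp_ge_add_one_self[of "t / c"] by simp
  qed
  then have "c * (1 + t / c) \<le>
      c * exp (t / c - (1 - \<delta>) * (if \<bar>t\<bar> \<le> \<delta> * \<alpha> then t\<^sup>2 / (2 * c\<^sup>2) else 0))"
    using c by (intro mult_left_mono) auto
  then show ?thesis
    using c by (simp add: distrib_left)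
qed

section \<open>Incidence sums over regular graphs\<close>

lemma regular_graph_complete: "regular_graph (CARD('n) - 1) (nsets (UNIV :: 'n::finite set) 2)"
proof -
  have "card {e \<in> nsets UNIV 2. i \<in> e} = CARD('n) - 1" for i :: 'n
  proof -
    have "{e \<in> nsets UNIV 2. i \<in> e} = (\<lambda>j. {i, j}) ` (UNIV - {i})"
      by (auto simp: nsets_def card_2_iff)
    moreover have "inj_on (\<lambda>j. {i, j}) (UNIV - {i})"
      by (auto simp: inj_on_def doubleton_eq_iff)
    ultimately show ?thesis
      by (simp add: card_image)
  qed
  then show ?thesis
    by (simp add: regular_graph_def)
qed

lemma sum_incidence:
  fixes E :: "'n::finite set set" and v :: "real ^ 'n"
  assumes "regular_graph d E"
  shows "(\<Sum>e\<in>E. \<Sum>i\<in>e. v $ i) = real d * (\<Sum>i\<in>UNIV. v $ i)"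
proof -
  have "(\<Sum>e\<in>E. \<Sum>i\<in>e. v $ i) = (\<Sum>e\<in>E. \<Sum>i\<in>UNIV. if i \<in> e then v $ i else 0)"
    by (simp add: sum.If_cases)
  also have "\<dots> = (\<Sum>i\<in>UNIV. \<Sum>e\<in>E. if i \<in> e then v $ i else 0)"
    by (rule sum.swap)
  also have "\<dots> = (\<Sum>i\<in>UNIV. real (card {e \<in> E. i \<in> e}) * v $ i)"
    by (simp add: sum.If_cases Int_def)
  also have "\<dots> = real d * (\<Sum>i\<in>UNIV. v $ i)"
    using assms by (simp add: regular_graph_def sum_distrib_left)
  finally show ?thesis .
qed

text \<open>
  The entries of \<open>B B\<^sup>T = d I + A\<close>: a pair of distinct vertices lies in at most one edge, and a
  single vertex lies in \<open>d\<close> of them; the diagonal of \<open>A\<close> is zero because \<open>{i, i}\<close> has only one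
  element.
\<close>

lemma codegree_regular:
  fixes E :: "'n::finite set set"
  assumes "regular_graph d E"
  shows "real (card {e \<in> E. i \<in> e \<and> j \<in> e}) = (if i = j then real d else 0) + adj_matrix E $ i $ j"
proof -
  have two: "card e = 2" if "e \<in> E" for e
    using assms that by (auto simp: regular_graph_def nsets_def)
  show ?thesis
  proof (cases "i = j")
    case True
    have "{i} \<notin> E"
      using two[of "{i}"] by auto
    then show ?thesis
      using assms True by (simp add: regular_graph_def adj_matrix_def)
  next
    case False
    have "e = {i, j}" if "e \<in> E" "i \<in> e" "j \<in> e" for e
      using card_subset_eq[of e "{i, j}"] two[OF that(1)] that False by simp
    then have "{e \<in> E. i \<in> e \<and> j \<in> e} = {{i, j}} \<inter> E"
      by blast
    then show ?thesis
      using False by (simp add: adj_matrix_def)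
  qed
qed

lemma sum_incidence_square:
  fixes E :: "'n::finite set set" and v :: "real ^ 'n"
  assumes "regular_graph d E"
  shows "(\<Sum>e\<in>E. (\<Sum>i\<in>e. v $ i)\<^sup>2) = real d * (v \<bullet> v) + v \<bullet> (adj_matrix E *v v)"
proof -
  have "(\<Sum>e\<in>E. (\<Sum>i\<in>e. v $ i)\<^sup>2)
      = (\<Sum>e\<in>E. \<Sum>i\<in>UNIV. \<Sum>j\<in>UNIV. if i \<in> e \<and> j \<in> e then v $ i * v $ j else 0)"
  proof (rule sum.cong[OF refl])
    fix e
    have "(\<Sum>i\<in>e. v $ i)\<^sup>2 = (\<Sum>i\<in>UNIV. if i \<in> e then v $ i else 0)\<^sup>2"
      by (simp add: sum.If_cases)
    also have "\<dots> = (\<Sum>i\<in>UNIV. \<Sum>j\<in>UNIV. (if i \<in> e then v $ i else 0) * (if j \<in> e then v $ j else 0))"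
      unfolding power2_eq_square by (rule sum_product)
    also have "\<dots> = (\<Sum>i\<in>UNIV. \<Sum>j\<in>UNIV. if i \<in> e \<and> j \<in> e then v $ i * v $ j else 0)"
      by (intro sum.cong refl) simp
    finally show "(\<Sum>i\<in>e. v $ i)\<^sup>2
      = (\<Sum>i\<in>UNIV. \<Sum>j\<in>UNIV. if i \<in> e \<and> j \<in> e then v $ i * v $ j else 0)" .
  qed
  also have "\<dots> = (\<Sum>i\<in>UNIV. \<Sum>e\<in>E. \<Sum>j\<in>UNIV. if i \<in> e \<and> j \<in> e then v $ i * v $ j else 0)"
    by (rule sum.swap)
  also have "\<dots> = (\<Sum>i\<in>UNIV. \<Sum>j\<in>UNIV. \<Sum>e\<in>E. if i \<in> e \<and> j \<in> e then v $ i * v $ j else 0)"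
    by (rule sum.cong[OF refl], rule sum.swap)
  also have "\<dots> = (\<Sum>i\<in>UNIV. \<Sum>j\<in>UNIV. real (card {e \<in> E. i \<in> e \<and> j \<in> e}) * (v $ i * v $ j))"
    by (simp add: sum.If_cases Int_def)
  also have "\<dots> = (\<Sum>i\<in>UNIV. \<Sum>j\<in>UNIV. (if i = j then real d * (v $ i * v $ j) else 0)
                                        + v $ i * (adj_matrix E $ i $ j * v $ j))"
    unfolding codegree_regular[OF assms] by (intro sum.cong refl) (simp add: distrib_left distrib_right mult_ac)
  also have "\<dots> = real d * (v \<bullet> v) + v \<bullet> (adj_matrix E *v v)"
    unfolding sum.distrib inner_vec_def matrix_vector_mult_def
    by (simp add: sum_distrib_left)
  finally show ?thesis .
qed

lemma adj_matrix_complete_form: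
  fixes v :: "real ^ 'n::finite"
  shows "v \<bullet> (adj_matrix (nsets UNIV 2) *v v) = (\<Sum>i\<in>UNIV. v $ i)\<^sup>2 - v \<bullet> v"
proof -
  have pair: "{i, j} \<in> nsets UNIV 2 \<longleftrightarrow> i \<noteq> j" for i j :: 'n
    by (cases "i = j") (auto simp: nsets_def)
  have row: "(adj_matrix (nsets UNIV 2) *v v) $ i = (\<Sum>j\<in>UNIV. v $ j) - v $ i" for i
  proof -
    have "(adj_matrix (nsets UNIV 2) *v v) $ i = (\<Sum>j\<in>UNIV. (if {i, j} \<in> nsets UNIV 2 then 1 else 0) * v $ j)"
      by (simp add: matrix_vector_mult_def adj_matrix_def)
    also have "\<dots> = (\<Sum>j\<in>UNIV. v $ j - (if i = j then v $ j else 0))"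
      by (intro sum.cong refl) (simp only: pair, simp)
    finally show ?thesis
      by (simp add: sum_subtractf)
  qed
  have "v \<bullet> (adj_matrix (nsets UNIV 2) *v v) = (\<Sum>i\<in>UNIV. v $ i * (\<Sum>j\<in>UNIV. v $ j) - v $ i * v $ i)"
    unfolding inner_vec_def by (intro sum.cong refl) (simp only: row inner_real_def right_diff_distrib)
  also have "\<dots> = (\<Sum>i\<in>UNIV. v $ i)\<^sup>2 - v \<bullet> v"
    unfolding sum_subtractf sum_distrib_right[symmetric] by (simp add: power2_eq_square inner_vec_def)
  finally show ?thesis .
qed

section \<open>Deviations from the mean\<close>

lemma sum_dev: "(\<Sum>i\<in>UNIV. dev a $ i) = 0"
  by (simp add: dev_def mean_def sum_subtractf)

lemma mean_bounds:
  fixes a :: "real ^ 'n"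
  assumes "\<forall>i. a $ i \<in> {l..u}"
  shows "l \<le> mean a" "mean a \<le> u"
proof -
  have "real CARD('n) * l \<le> (\<Sum>i\<in>UNIV. a $ i)"
    using sum_bounded_below[of UNIV l "($) a"] assms by simp
  then show "l \<le> mean a"
    by (simp add: mean_def le_divide_eq mult.commute)
  have "(\<Sum>i\<in>UNIV. a $ i) \<le> real CARD('n) * u"
    using sum_bounded_above[of UNIV "($) a" u] assms by simp
  then show "mean a \<le> u"
    by (simp add: mean_def divide_le_eq mult.commute)
qed

lemma pair_avg_eq_mean_plus_pair_w:
  assumes "e \<in> nsets UNIV 2"
  shows "pair_avg a e = mean a + pair_w a e"
  using assms by (auto simp: nsets_def card_2_iff pair_w_def pair_avg_def dev_def field_simps)

lemma pair_avg_bounds: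
  assumes "\<forall>i. a $ i \<in> {l..u}" "e \<in> nsets UNIV 2"
  shows "pair_avg a e \<in> {l..u}"
proof -
  obtain i j where "e = {i, j}" "i \<noteq> j"
    using assms(2) by (auto simp: nsets_def card_2_iff)
  then show ?thesis
    using assms(1)[rule_format, of i] assms(1)[rule_format, of j] by (simp add: pair_avg_def)
qed

text \<open>The linear terms of the expansion cancel on a regular graph, as each vertex is counted
  equally often.\<close>

lemma sum_pair_w_regular:
  fixes a :: "real ^ 'n"
  assumes "regular_graph d E"
  shows "(\<Sum>e\<in>E. pair_w a e) = 0"
  using sum_incidence[OF assms, of "dev a"]
  by (simp add: pair_w_def pair_avg_def sum_dev flip: sum_divide_distrib)

lemma sum_pair_w_square_regular:
  fixes a :: "real ^ 'n"
  assumes "regular_graph d E"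
  shows "4 * (\<Sum>e\<in>E. (pair_w a e)\<^sup>2) = real d * (dev a \<bullet> dev a) + dev a \<bullet> (adj_matrix E *v dev a)"
  using sum_incidence_square[OF assms, of "dev a"]
  by (simp add: pair_w_def pair_avg_def power_divide flip: sum_divide_distrib)

lemma sum_pair_w_square_complete:
  fixes a :: "real ^ 'n"
  shows "4 * (\<Sum>e\<in>nsets UNIV 2. (pair_w a e)\<^sup>2) = (real CARD('n) - 2) * (dev a \<bullet> dev a)"
proof -
  have "real (CARD('n) - 1) = real CARD('n) - 1"
    by (simp add: of_nat_diff Suc_leI)
  then show ?thesis
    using sum_pair_w_square_regular[OF regular_graph_complete, of a]
    by (simp add: adj_matrix_complete_form sum_dev algebra_simps)
qed

section \<open>Probability of a fixed graph\<close>

text \<open>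
  Forming the edge set loses the values of an indicator function outside the pairs, but those are
  almost surely \<open>False\<close>; so the event that the graph is \<open>H\<close> agrees, up to a null set, with the
  event that the indicator function is that of \<open>H\<close>.
\<close>

lemma prob_random_graph:
  fixes a :: "real ^ 'n" and H :: "'n set set"
  assumes H: "H \<subseteq> nsets UNIV 2"
    and prob: "\<And>e. e \<in> nsets UNIV 2 \<Longrightarrow> pair_avg a e \<in> {0..1}"
  shows "measure_pmf.prob (random_graph a) {H}
    = (\<Prod>e\<in>H. pair_avg a e) * (\<Prod>e\<in>nsets UNIV 2 - H. 1 - pair_avg a e)"
proof -
  let ?N = "nsets (UNIV :: 'n set) 2"
  let ?P = "Pi_pmf ?N False (\<lambda>e. bernoulli_pmf (pair_avg a e))"
  have fin: "finite ?N" by simp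
  have "measure_pmf.prob (random_graph a) {H} = measure_pmf.prob ?P ((\<lambda>X. {e \<in> ?N. X e}) -` {H})"
    by (simp add: random_graph_def)
  also have "\<dots> = measure_pmf.prob ?P {\<lambda>e. e \<in> H}"
  proof (rule measure_prob_cong_0)
    fix X assume X: "X \<in> (\<lambda>X. {e \<in> ?N. X e}) -` {H} - {\<lambda>e. e \<in> H}"
    then have "\<exists>e. e \<notin> ?N \<and> X e"
      by auto
    then show "pmf ?P X = 0"
      by (auto simp: pmf_Pi)
  next
    fix X assume "X \<in> {\<lambda>e. e \<in> H} - (\<lambda>X. {e \<in> ?N. X e}) -` {H}"
    with H show "pmf ?P X = 0"
      by auto
  qed
  also have "\<dots> = (\<Prod>e\<in>?N. pmf (bernoulli_pmf (pair_avg a e)) (e \<in> H))"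
    using H by (subst measure_pmf_single, subst pmf_Pi) auto
  also have "\<dots> = (\<Prod>e\<in>?N - H. pmf (bernoulli_pmf (pair_avg a e)) (e \<in> H))
      * (\<Prod>e\<in>H. pmf (bernoulli_pmf (pair_avg a e)) (e \<in> H))"
    by (rule prod.subset_diff[OF H fin])
  also have "(\<Prod>e\<in>H. pmf (bernoulli_pmf (pair_avg a e)) (e \<in> H)) = (\<Prod>e\<in>H. pair_avg a e)"
    using H prob by (intro prod.cong) auto
  also have "(\<Prod>e\<in>?N - H. pmf (bernoulli_pmf (pair_avg a e)) (e \<in> H))
      = (\<Prod>e\<in>?N - H. 1 - pair_avg a e)"
    using prob by (intro prod.cong) auto
  finally show ?thesis
    by (simp add: mult.commute)
qed

text \<open>
  Restricting the sums to good pairs is the same as giving bad pairs the exponent \<open>0\<close>; in this form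
  every pair has one factor and one exponent, to which \<open>factor_bound\<close> applies without a case split.
\<close>

lemma bracket_eq_conditional_sums:
  assumes "E \<subseteq> nsets UNIV 2"
  shows "bracket \<alpha> \<delta> a E =
    (\<Sum>e\<in>E. if \<bar>pair_w a e\<bar> \<le> \<delta> * \<alpha> then (pair_w a e)\<^sup>2 / (2 * (mean a)\<^sup>2) else 0) +
    (\<Sum>e\<in>nsets UNIV 2 - E. if \<bar>pair_w a e\<bar> \<le> \<delta> * \<alpha> then (pair_w a e)\<^sup>2 / (2 * (1 - mean a)\<^sup>2) else 0)"
  using assms
  by (simp add: bracket_def good_pair_def sum.If_cases finite_subset Int_def conj_assoc)

lemma prod_mult_exp:
  fixes c :: real
  assumes "finite A"
  shows "(\<Prod>e\<in>A. c * exp (g e)) = c ^ card A * exp (\<Sum>e\<in>A. g e)"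
  using assms by (simp add: prod.distrib exp_sum)

lemma prob_regular_graph_le:
  fixes \<alpha> \<delta> :: real and a :: "real ^ 'n" and H :: "'n set set"
  assumes \<alpha>: "0 < \<alpha>" and \<delta>: "0 \<le> \<delta>" "\<delta> < 1"
    and a: "\<forall>i. a $ i \<in> {\<alpha>..1 - \<alpha>}" and H: "regular_graph d H"
  shows "measure_pmf.prob (random_graph a) {H}
    \<le> mean a ^ card H * (1 - mean a) ^ card (nsets (UNIV :: 'n set) 2 - H)
        * exp (- (1 - \<delta>) * bracket \<alpha> \<delta> a H)"
proof -
  let ?N = "nsets (UNIV :: 'n set) 2"
  let ?p = "mean a" and ?q = "1 - mean a" and ?w = "pair_w a"
  define g where "g c t = (if \<bar>t\<bar> \<le> \<delta> * \<alpha> then t\<^sup>2 / (2 * c\<^sup>2) else 0)" for c t :: real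
  have HN: "H \<subseteq> ?N" using H by (simp add: regular_graph_def)
  have fin: "finite H" "finite (?N - H)" by simp_all
  have p: "\<alpha> \<le> ?p" and q: "\<alpha> \<le> ?q" using mean_bounds[OF a] by auto
  have avg: "pair_avg a e \<in> {\<alpha>..1 - \<alpha>}" if "e \<in> ?N" for e
    using pair_avg_bounds[OF a that] .
  then have prob: "pair_avg a e \<in> {0..1}" if "e \<in> ?N" for e
    using that \<alpha> by fastforce
  have zeroH: "(\<Sum>e\<in>H. ?w e) = 0"
    by (rule sum_pair_w_regular[OF H])
  have zeroN: "(\<Sum>e\<in>?N - H. ?w e) = 0"
    using sum_pair_w_regular[OF regular_graph_complete, of a] zeroH HN
    by (simp add: sum_diff)
  have edges: "(\<Prod>e\<in>H. pair_avg a e) \<le> (\<Prod>e\<in>H. ?p * exp (?w e / ?p - (1 - \<delta>) * g ?p (?w e)))"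
  proof (rule prod_mono)
    fix e assume "e \<in> H"
    then have "e \<in> ?N" using HN by auto
    then show "0 \<le> pair_avg a e \<and> pair_avg a e \<le> ?p * exp (?w e / ?p - (1 - \<delta>) * g ?p (?w e))"
      using factor_bound[OF \<alpha> p \<delta>, of "?w e"] prob[of e]
      by (simp add: pair_avg_eq_mean_plus_pair_w g_def)
  qed
  have nonedges: "(\<Prod>e\<in>?N - H. 1 - pair_avg a e)
      \<le> (\<Prod>e\<in>?N - H. ?q * exp (- ?w e / ?q - (1 - \<delta>) * g ?q (?w e)))"
  proof (rule prod_mono)
    fix e assume "e \<in> ?N - H"
    then have "e \<in> ?N" by auto
    then show "0 \<le> 1 - pair_avg a e
        \<and> 1 - pair_avg a e \<le> ?q * exp (- ?w e / ?q - (1 - \<delta>) * g ?q (?w e))"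
      using factor_bound[OF \<alpha> q \<delta>, of "- ?w e"] prob[of e]
      by (simp add: pair_avg_eq_mean_plus_pair_w g_def diff_diff_eq cong: if_cong)
  qed
  have "measure_pmf.prob (random_graph a) {H}
      = (\<Prod>e\<in>H. pair_avg a e) * (\<Prod>e\<in>?N - H. 1 - pair_avg a e)"
    by (rule prob_random_graph[OF HN prob])
  also have "\<dots> \<le> (\<Prod>e\<in>H. ?p * exp (?w e / ?p - (1 - \<delta>) * g ?p (?w e)))
      * (\<Prod>e\<in>?N - H. ?q * exp (- ?w e / ?q - (1 - \<delta>) * g ?q (?w e)))"
    using edges nonedges prob HN p q \<alpha> by (intro mult_mono prod_nonneg) auto
  also have "\<dots> = ?p ^ card H * exp (- (1 - \<delta>) * (\<Sum>e\<in>H. g ?p (?w e)))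
      * (?q ^ card (?N - H) * exp (- (1 - \<delta>) * (\<Sum>e\<in>?N - H. g ?q (?w e))))"
  proof -
    have "(\<Sum>e\<in>H. ?w e / ?p - (1 - \<delta>) * g ?p (?w e)) = - (1 - \<delta>) * (\<Sum>e\<in>H. g ?p (?w e))"
      unfolding sum_subtractf sum_distrib_left[symmetric] sum_divide_distrib[symmetric] zeroH
      by (simp add: algebra_simps)
    moreover have "(\<Sum>e\<in>?N - H. - ?w e / ?q - (1 - \<delta>) * g ?q (?w e))
        = - (1 - \<delta>) * (\<Sum>e\<in>?N - H. g ?q (?w e))"
      unfolding sum_subtractf sum_distrib_left[symmetric] sum_divide_distrib[symmetric] sum_negf
        zeroN by (simp add: algebra_simps)
    ultimately show ?thesis
      by (simp only: prod_mult_exp[OF fin(1)] prod_mult_exp[OF fin(2)])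
  qed
  also have "\<dots> = ?p ^ card H * ?q ^ card (?N - H) * exp (- (1 - \<delta>) * bracket \<alpha> \<delta> a H)"
    unfolding bracket_eq_conditional_sums[OF HN] g_def[symmetric] distrib_left exp_add
    by (simp add: mult_ac)
  finally show ?thesis .
qed

section \<open>The quadratic form\<close>

lemma good_pair_if_dev_small:
  assumes "\<And>i. \<bar>dev a $ i\<bar> \<le> \<delta> * \<alpha>" "e \<in> nsets UNIV 2"
  shows "good_pair \<alpha> \<delta> a e"
proof -
  obtain i j where "e = {i, j}" "i \<noteq> j"
    using assms(2) by (auto simp: nsets_def card_2_iff)
  then show ?thesis
    using assms(1)[of i] assms(1)[of j]
    by (simp add: good_pair_def pair_w_def pair_avg_doubleton)
qed

lemma bracket_eq_quadratic_form:
  fixes a :: "real ^ 'n" and H :: "'n set set"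
  assumes H: "regular_graph d H" and good: "\<forall>e \<in> nsets UNIV 2. good_pair \<alpha> \<delta> a e"
  shows "bracket \<alpha> \<delta> a H = dev a \<bullet> (Q_matrix d a H *v dev a)"
proof -
  let ?N = "nsets (UNIV :: 'n set) 2" and ?y = "dev a"
  let ?r = "1 / (mean a)\<^sup>2" and ?s = "1 / (1 - mean a)\<^sup>2"
  let ?SH = "\<Sum>e\<in>H. (pair_w a e)\<^sup>2" and ?SN = "\<Sum>e\<in>?N. (pair_w a e)\<^sup>2"
  have HN: "H \<subseteq> ?N" using H by (simp add: regular_graph_def)
  have sets: "{e. e \<in> H \<and> good_pair \<alpha> \<delta> a e} = H"
    "{e. e \<in> ?N \<and> e \<notin> H \<and> good_pair \<alpha> \<delta> a e} = ?N - H"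
    using good HN by auto
  have diff: "(\<Sum>e\<in>?N - H. (pair_w a e)\<^sup>2) = ?SN - ?SH"
    using HN by (simp add: sum_diff)
  have "bracket \<alpha> \<delta> a H = ?r / 2 * ?SH + ?s / 2 * (?SN - ?SH)"
    unfolding bracket_def sets diff[symmetric] sum_distrib_left
    by (simp add: mult.commute)
  also have "\<dots> = (?r * (4 * ?SH) + ?s * (4 * ?SN - 4 * ?SH)) / 8"
    by (simp only: right_diff_distrib) simp
  also have "\<dots> = ((real d * ?r + (real CARD('n) - 2 - real d) * ?s) * (?y \<bullet> ?y)
      + (?r - ?s) * (?y \<bullet> (adj_matrix H *v ?y))) / 8"
    unfolding sum_pair_w_square_regular[OF H] sum_pair_w_square_complete
    by (simp only: algebra_simps)
  also have "\<dots> = ?y \<bullet> (Q_matrix d a H *v ?y)"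
    by (simp add: Q_matrix_def scaleR_matrix_vector_assoc[symmetric] matrix_vector_mult_add_rdistrib
        inner_add_right)
  finally show ?thesis .
qed

theorem proposition2p3:
  fixes \<alpha> \<delta> :: real and a :: "real ^ 'n" and d :: nat and H :: "'n set set"
  assumes "0 < \<alpha>" and "\<alpha> < 1 / 2"
    and "0 < \<delta>" and "\<delta> \<le> 1 / 4"
    and "\<forall>i. a $ i \<in> {\<alpha>..1 - \<alpha>}"
    and "regular_graph d H"
  defines "m \<equiv> CARD('n) * d div 2" and "K \<equiv> CARD('n) choose 2"
  shows "measure_pmf.prob (random_graph a) {H}
           \<le> mean a ^ m * (1 - mean a) ^ (K - m) * exp (- (1 - \<delta>) * bracket \<alpha> \<delta> a H)
       \<and> ((MAX i. \<bar>dev a $ i\<bar>) \<le> \<delta> * \<alpha> \<longrightarrow>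
             (\<forall>e \<in> nsets UNIV 2. good_pair \<alpha> \<delta> a e) \<and>
             bracket \<alpha> \<delta> a H = dev a \<bullet> (Q_matrix d a H *v dev a))"
proof (intro conjI impI)
  have m: "card H = m"
    using regular_graph_card_edges[OF assms(6)] by (simp add: m_def)
  have "card (nsets (UNIV :: 'n set) 2 - H) = K - m"
    using assms(6) m by (simp add: regular_graph_def card_Diff_subset K_def)
  then show "measure_pmf.prob (random_graph a) {H}
      \<le> mean a ^ m * (1 - mean a) ^ (K - m) * exp (- (1 - \<delta>) * bracket \<alpha> \<delta> a H)"
    using prob_regular_graph_le[of \<alpha> \<delta> a d H] assms(1-6) m by simp
next
  assume max: "(MAX i. \<bar>dev a $ i\<bar>) \<le> \<delta> * \<alpha>"
  have "\<bar>dev a $ i\<bar> \<le> \<delta> * \<alpha>" for i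
    using max by simp
  then show good: "\<forall>e \<in> nsets UNIV 2. good_pair \<alpha> \<delta> a e"
    using good_pair_if_dev_small by blast
  show "bracket \<alpha> \<delta> a H = dev a \<bullet> (Q_matrix d a H *v dev a)"
    by (rule bracket_eq_quadratic_form[OF assms(6) good])
qed

end
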